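(* Let $S=[0,1]^3$ be the unit cube. Among all admissible orientations of $S$, the drainage time $T(R)$ attains its minimum when one of the cube's space diagonals is vertical, and $$T_{\min}=\frac{8\sqrt[4]{3}}{5K}\left(1+3\sqrt{3}-4\sqrt{2}\right).$$
   Context: For a rotation $R$ of $\mathbb{R}^3$, let $S_R$ be the translate of $R(S)$ lying in $\{z\ge0\}$ and touching the plane $z=0$ (the orifice is at the lowest point of the container). The drainage time is $T(R)=\frac1K\iiint_{S_R} z^{-1/2}\,dV=\frac1K\int_0^H A(h)h^{-1/2}\,dh$, where $K>0$ is a fixed constant, $A(h)$ is the area of the horizontal cross-section at height $h$ and $H$ is the height of $S_R$ (this is the total drainage time under Torricelli's law $A(h)h'=-ka\sqrt{2gh}$, $K=ka\sqrt{2g}$). $T_{\min}$ denotes the minimum of $T(R)$ over all rotations $R$. *)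

theory Defs
  imports "HOL-Analysis.Analysis"
begin

text \<open>Points of R^3 are of type real^3; the vertical (z) coordinate is component 3.
  Rotations are rotation matrices Q (orthogonal, det = 1) acting by Q *v x.\<close>

definition zc :: "real^3 \<Rightarrow> real" where
  "zc x = x $ 3"

definition unit_cube :: "(real^3) set" where
  "unit_cube = cbox 0 1"

text \<open>Height of the lowest point of the rotated cube.\<close>
definition low :: "real^3^3 \<Rightarrow> real" where
  "low Q = (INF x\<in>unit_cube. zc (Q *v x))"

text \<open>S_R: translate of R(S) lying in z >= 0 and touching z = 0.\<close>
definition placed :: "real^3^3 \<Rightarrow> (real^3) set" where
  "placed Q = (\<lambda>x. Q *v x - low Q *\<^sub>R axis 3 1) ` unit_cube"

text \<open>Drainage time T(R) = (1/K) * triple integral over S_R of z^(-1/2).\<close>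
definition drain_time :: "real \<Rightarrow> real^3^3 \<Rightarrow> real" where
  "drain_time K Q = (1 / K) * integral (placed Q) (\<lambda>p. (zc p) powr (-1/2))"

definition T_min :: "real \<Rightarrow> real" where
  "T_min K = (INF Q\<in>{Q. rotation_matrix Q}. drain_time K Q)"

text \<open>Some space diagonal of the cube (direction with all entries +-1) is mapped to a vertical vector.\<close>
definition diagonal_vertical :: "real^3^3 \<Rightarrow> bool" where
  "diagonal_vertical Q \<longleftrightarrow>
     (\<exists>d::real^3. (\<forall>i. d $ i = 1 \<or> d $ i = -1) \<and> (\<exists>c. Q *v d = c *\<^sub>R axis 3 1))"

end

theory Submission
  imports Defs
begin

text \<open>
  After a rigid motion that also reflects the cube in the planes through its centre, the lowest
  vertex sits at the origin and \<open>K * T(R)\<close> becomes the integral of \<open>(u \<bullet> y) powr (-1/2)\<close>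
  over the unit cube, where \<open>u\<close> is the vector of absolute values of the bottom row of the
  rotation: a unit vector with nonnegative entries.  Permuting the entries of \<open>u\<close> does not
  change this integral.  Averaging over the cyclic shifts of \<open>u\<close>, whose inner products with
  \<open>y\<close> add up to \<open>(\<Sum>u) (\<Sum>y)\<close>, and applying Jensen's inequality to the convex function
  \<open>t powr (-1/2)\<close> bounds it below by \<open>(\<Sum>u / 3) powr (-1/2) * J\<close>, where \<open>J\<close> is the
  integral of \<open>(y\<^sub>1 + y\<^sub>2 + y\<^sub>3) powr (-1/2)\<close> over the unit cube, equal to
  \<open>8/5 * (1 + 3 * sqrt 3 - 4 * sqrt 2)\<close> by iterated integration.  Cauchy-Schwarz gives
  \<open>\<Sum>u \<le> sqrt 3\<close> and hence the lower bound \<open>3 powr (1/4) * J\<close>, which is attained at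
  \<open>u = (1, 1, 1) / sqrt 3\<close>, i.e. when a space diagonal is vertical.
\<close>

section \<open>Rigid motions of the unit cube\<close>

lemma has_integral_unimodular_affine_image:
  fixes f :: "real^'n::{finite,wellorder} \<Rightarrow> real" and A :: "real^'n::_^'n::_"
  assumes det: "\<bar>det A\<bar> = 1" and S: "S \<in> sets lebesgue"
    and nonneg: "\<And>x. x \<in> S \<Longrightarrow> 0 \<le> f (A *v x + t)"
    and int: "((\<lambda>x. f (A *v x + t)) has_integral I) S"
  shows "(f has_integral I) ((\<lambda>x. A *v x + t) ` S)"
proof -
  let ?g = "\<lambda>x. A *v x + t"
  \<comment> \<open>The change of variables theorem is stated for vector-valued integrands; go through \<open>real^1\<close>.\<close>
  have lift_integral: "((\<lambda>x. vec (h x) :: real^1) has_integral vec J) T \<longleftrightarrow> (h has_integral J) T"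
    for h :: "real^'n::_ \<Rightarrow> real" and J T
    by (simp add: has_integral_componentwise_iff[where y="vec J"] Basis_vec_def
        cart_eq_inner_axis[symmetric])
  have lift_abs: "(\<lambda>x. vec (h x) :: real^1) absolutely_integrable_on T \<longleftrightarrow> h absolutely_integrable_on T"
    for h :: "real^'n::_ \<Rightarrow> real" and T
    by (simp add: absolutely_integrable_componentwise_iff[where f="\<lambda>x. vec (h x) :: real^1"]
        Basis_vec_def cart_eq_inner_axis[symmetric])
  have der: "(?g has_derivative (*v) A) (at x within S)" for x
    by (intro has_derivative_add_const bounded_linear_imp_has_derivative matrix_vector_mul_bounded_linear)
  have "invertible A"
    using det by (auto simp: invertible_det_nz)
  then have inj: "inj_on ?g S"
    by (metis (no_types, lifting) add_right_cancel inj_on_def injD invertible_left_inverse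
        matrix_left_invertible_injective)
  have "(\<lambda>x. f (?g x)) absolutely_integrable_on S"
    using int nonneg by (intro nonnegative_absolutely_integrable_1) auto
  then have "(\<lambda>x. \<bar>det (matrix ((*v) A))\<bar> *\<^sub>R (vec (f (?g x)) :: real^1)) absolutely_integrable_on S \<and>
      integral S (\<lambda>x. \<bar>det (matrix ((*v) A))\<bar> *\<^sub>R (vec (f (?g x)) :: real^1)) = vec I"
    using int det lift_integral lift_abs by (simp add: integral_unique)
  then have "(\<lambda>x. vec (f x) :: real^1) absolutely_integrable_on ?g ` S \<and>
      integral (?g ` S) (\<lambda>x. vec (f x) :: real^1) = vec I"
    by (rule has_absolute_integral_change_of_variables[OF S der inj, THEN iffD1])
  then have "((\<lambda>x. vec (f x) :: real^1) has_integral vec I) (?g ` S)"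
    using has_integral_iff absolutely_integrable_on_def by blast
  then show ?thesis
    using lift_integral by blast
qed

text \<open>The affine map \<open>y \<mapsto> cube_reflection u *v y + negative_coords u\<close> reflects the unit cube
  in the planes \<open>x\<^sub>i = 1/2\<close> with \<open>u\<^sub>i < 0\<close>; it sends \<open>0\<close> to the vertex minimising
  \<open>u \<bullet> x\<close>.\<close>

definition cube_reflection :: "real^'n \<Rightarrow> real^'n^'n" where
  "cube_reflection u = (\<chi> i j. if i = j then (if u $ i < 0 then -1 else 1) else 0)"

definition negative_coords :: "real^'n \<Rightarrow> real^'n" where
  "negative_coords u = (\<chi> i. if u $ i < 0 then 1 else 0)"

lemma cube_reflection_nth:
  "(cube_reflection u *v y) $ i = (if u $ i < 0 then - y $ i else y $ i)"
  by (simp add: cube_reflection_def matrix_vector_mult_def if_distrib[of "\<lambda>c. c * _"] cong: if_cong)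

lemma cube_reflection_involutive:
  "cube_reflection u *v (cube_reflection u *v y + negative_coords u) + negative_coords u = y"
  by (simp add: vec_eq_iff cube_reflection_nth negative_coords_def)

lemma abs_det_cube_reflection: "\<bar>det (cube_reflection u)\<bar> = 1"
proof -
  have "det (cube_reflection u) = (\<Prod>i\<in>UNIV. cube_reflection u $ i $ i)"
    by (rule det_diagonal) (simp add: cube_reflection_def)
  then show ?thesis
    by (auto simp: abs_prod cube_reflection_def intro!: prod.neutral)
qed

lemma cube_reflection_image:
  "(\<lambda>y. cube_reflection u *v y + negative_coords u) ` cbox 0 1 = cbox (0::real^'n) 1"
proof -
  let ?r = "\<lambda>y. cube_reflection u *v y + negative_coords u"
  have into: "?r y \<in> cbox 0 1" if "y \<in> cbox 0 1" for y
    using that by (auto simp: mem_box_cart cube_reflection_nth negative_coords_def)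
  show ?thesis
  proof (intro subset_antisym subsetI)
    fix y :: "real^'n" assume "y \<in> cbox 0 1"
    have "y = ?r (?r y)"
      by (simp only: cube_reflection_involutive)
    then show "y \<in> ?r ` cbox 0 1"
      using into[OF \<open>y \<in> cbox 0 1\<close>] by (rule image_eqI)
  qed (use into in blast)
qed

lemma inner_cube_reflection:
  "u \<bullet> (cube_reflection u *v y + negative_coords u) = (\<chi> i. \<bar>u $ i\<bar>) \<bullet> y + (\<Sum>i\<in>UNIV. min (u $ i) 0)"
  by (simp add: inner_vec_def cube_reflection_nth negative_coords_def flip: sum.distrib)
    (auto intro!: sum.cong simp: algebra_simps)

lemma Inf_inner_unit_cube:
  fixes u :: "real^'n"
  shows "(INF x\<in>cbox 0 1. u \<bullet> x) = (\<Sum>i\<in>UNIV. min (u $ i) 0)"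
proof (rule cInf_eq_minimum)
  have "u \<bullet> negative_coords u = (\<Sum>i\<in>UNIV. min (u $ i) 0)"
    unfolding inner_vec_def negative_coords_def by (intro sum.cong) auto
  moreover have "negative_coords u \<in> cbox 0 1"
    by (simp add: mem_box_cart negative_coords_def)
  ultimately show "(\<Sum>i\<in>UNIV. min (u $ i) 0) \<in> (\<lambda>x. u \<bullet> x) ` cbox 0 1"
    by (intro image_eqI[of _ _ "negative_coords u"]) simp_all
next
  fix z assume "z \<in> (\<lambda>x. u \<bullet> x) ` cbox 0 1"
  then obtain x where x: "x \<in> cbox 0 1" and z: "z = u \<bullet> x"
    by blast
  have "x \<in> (\<lambda>y. cube_reflection u *v y + negative_coords u) ` cbox 0 1"
    using x by (simp only: cube_reflection_image)
  then obtain y where y: "y \<in> cbox 0 1" and "x = cube_reflection u *v y + negative_coords u"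
    by blast
  have "0 \<le> (\<chi> i. \<bar>u $ i\<bar>) \<bullet> y"
    using y by (auto simp: inner_vec_def mem_box_cart intro!: sum_nonneg)
  then show "(\<Sum>i\<in>UNIV. min (u $ i) 0) \<le> z"
    using \<open>x = _\<close> by (simp add: z inner_cube_reflection)
qed

lemma permute_coords_matrix: "(\<chi> i. mat 1 $ p i) *v x = (\<chi> i. x $ p i)"
  by (simp add: vec_eq_iff matrix_vector_mult_def mat_def if_distrib[of "\<lambda>c. c * _"] cong: if_cong)

lemma permute_coords_unit_cube_image:
  assumes "p permutes UNIV"
  shows "(\<lambda>x. \<chi> i. x $ p i) ` cbox 0 1 = cbox (0::real^'n) 1"
proof (intro subset_antisym subsetI)
  fix x :: "real^'n" assume x: "x \<in> cbox 0 1"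
  have "x = (\<chi> i. (\<chi> j. x $ inv p j) $ p i)"
    using assms by (simp add: vec_eq_iff permutes_inverses)
  moreover have "(\<chi> j. x $ inv p j) \<in> cbox 0 1"
    using x by (simp add: mem_box_cart)
  ultimately show "x \<in> (\<lambda>x. \<chi> i. x $ p i) ` cbox 0 1"
    by (rule image_eqI)
qed (auto simp: mem_box_cart)

lemma has_integral_unit_cube_permute_coords:
  fixes f :: "real^'n::{finite,wellorder} \<Rightarrow> real"
  assumes p: "p permutes UNIV" and nonneg: "\<And>y. y \<in> cbox 0 1 \<Longrightarrow> 0 \<le> f y"
    and int: "(f has_integral I) (cbox 0 1)"
  shows "((\<lambda>y. f (\<chi> i. y $ p i)) has_integral I) (cbox 0 1)"
proof -
  let ?P = "\<chi> i. (mat 1 :: real^'n::_^'n::_) $ inv p i"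
  have inv_p: "inv p permutes UNIV"
    using p by (rule permutes_inv)
  have "det ?P = of_int (sign (inv p))"
    using det_permute_rows[OF inv_p, of "mat 1"] by simp
  then have "\<bar>det ?P\<bar> = 1"
    by (simp add: sign_def)
  moreover have "f (\<chi> i. (?P *v y + 0) $ p i) = f y" for y
    using p by (simp add: permute_coords_matrix permutes_inverses vec_eq_iff)
  ultimately have "((\<lambda>y. f (\<chi> i. y $ p i)) has_integral I) ((\<lambda>y. ?P *v y + 0) ` cbox 0 1)"
    using nonneg int by (intro has_integral_unimodular_affine_image) auto
  then show ?thesis
    by (simp add: permute_coords_matrix permute_coords_unit_cube_image[OF inv_p])
qed

section \<open>Averaging over cyclic shifts\<close>

definition cube_drain_integral :: "real^'n \<Rightarrow> real" where
  "cube_drain_integral v = integral (cbox 0 1) (\<lambda>y. (v \<bullet> y) powr (-1/2))"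

lemma powr_neg_half: "0 \<le> x \<Longrightarrow> x powr (-1/2) = 1 / sqrt x"
  by (cases "x = 0") (simp_all add: powr_minus_divide powr_half_sqrt)

lemma inv_sqrt_ge_tangent:
  assumes "0 < t" and "0 < m"
  shows "(3 * m - t) / (2 * m * sqrt m) \<le> 1 / sqrt t"
proof -
  define x u where "x = sqrt t" and "u = sqrt m"
  have x: "0 < x" and u: "0 < u" and t: "t = x\<^sup>2" and m: "m = u\<^sup>2"
    using assms by (auto simp: x_def u_def)
  have "0 \<le> (x - u)\<^sup>2 * (x + 2 * u)"
    using x u by simp
  then have "(3 * u\<^sup>2 - x\<^sup>2) * x \<le> 2 * u\<^sup>2 * u"
    by (simp add: algebra_simps power2_eq_square)
  then show ?thesis
    using x u by (simp add: t m divide_simps mult.commute)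
qed

lemma powr_neg_half_mean_le:
  assumes "finite A" and "A \<noteq> {}" and pos: "\<And>k. k \<in> A \<Longrightarrow> 0 < t k"
  shows "card A * ((\<Sum>k\<in>A. t k) / card A) powr (-1/2) \<le> (\<Sum>k\<in>A. t k powr (-1/2))"
proof -
  define n m where "n = real (card A)" and "m = (\<Sum>k\<in>A. t k) / n"
  have n: "0 < n"
    using assms by (simp add: n_def card_gt_0_iff)
  have m: "0 < m"
    using assms pos n by (simp add: m_def sum_pos)
  have "(\<Sum>k\<in>A. 3 * m - t k) = 2 * n * m"
    using n by (simp add: sum_subtractf m_def n_def)
  then have "n * (1 / sqrt m) = (\<Sum>k\<in>A. 3 * m - t k) / (2 * m * sqrt m)"
    using m by (simp add: field_simps)
  also have "\<dots> = (\<Sum>k\<in>A. (3 * m - t k) / (2 * m * sqrt m))"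
    by (simp add: sum_divide_distrib)
  also have "\<dots> \<le> (\<Sum>k\<in>A. 1 / sqrt (t k))"
    by (intro sum_mono inv_sqrt_ge_tangent pos m)
  finally have "n * (1 / sqrt m) \<le> (\<Sum>k\<in>A. 1 / sqrt (t k))" .
  moreover have "(\<Sum>k\<in>A. t k powr (-1/2)) = (\<Sum>k\<in>A. 1 / sqrt (t k))"
    using pos by (intro sum.cong refl powr_neg_half) (simp add: less_imp_le)
  moreover have "m powr (-1/2) = 1 / sqrt m"
    using m by (intro powr_neg_half) simp
  ultimately show ?thesis
    by (simp add: n_def m_def)
qed

lemma inner_pos_if_coords_pos:
  fixes w y :: "real^'n"
  assumes "\<And>i. 0 \<le> w $ i" and "0 < (\<Sum>i\<in>UNIV. w $ i)" and "\<And>i. 0 < y $ i"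
  shows "0 < w \<bullet> y"
proof -
  obtain i where "0 < w $ i"
  proof (rule ccontr)
    assume "\<not> thesis"
    with that have "\<And>i. w $ i \<le> 0"
      by (meson not_less)
    then show False
      using assms(2) sum_nonpos[of UNIV "\<lambda>i. w $ i"] by simp
  qed
  moreover have "0 \<le> w $ j * y $ j" for j
    using assms(1)[of j] assms(3)[of j] by simp
  ultimately show ?thesis
    unfolding inner_vec_def using assms(3)[of i] by (intro sum_pos2[of UNIV i]) simp_all
qed

text \<open>The additive group structure of the index type supplies the coordinate shifts
  \<open>i \<mapsto> i + k\<close>; for the numeral type \<open>3\<close> these are the cyclic permutations.\<close>

lemma sum_shift_coords:
  fixes v :: "'a::comm_monoid_add^'n::{finite,ab_group_add}"
  shows "(\<Sum>k\<in>UNIV. v $ (i + k)) = (\<Sum>j\<in>UNIV. v $ j)"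
  by (rule sum.reindex_bij_witness[of _ "\<lambda>j. j - i" "\<lambda>k. i + k"]) auto

lemma inner_shift_coords:
  fixes v y :: "real^'n::{finite,ab_group_add}"
  shows "(\<chi> i. v $ (i + k)) \<bullet> y = v \<bullet> (\<chi> i. y $ (i - k))"
  unfolding inner_vec_def
  by (rule sum.reindex_bij_witness[of _ "\<lambda>i. i - k" "\<lambda>i. i + k"]) auto

lemma sum_inner_shift_coords:
  fixes v y :: "real^'n::{finite,ab_group_add}"
  shows "(\<Sum>k\<in>UNIV. (\<chi> i. v $ (i + k)) \<bullet> y) = (\<Sum>i\<in>UNIV. v $ i) * (\<Sum>i\<in>UNIV. y $ i)"
proof -
  have "(\<Sum>k\<in>UNIV. (\<chi> i. v $ (i + k)) \<bullet> y) = (\<Sum>k\<in>UNIV. \<Sum>i\<in>UNIV. v $ (i + k) * y $ i)"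
    by (simp add: inner_vec_def)
  also have "\<dots> = (\<Sum>i\<in>UNIV. \<Sum>k\<in>UNIV. v $ (i + k) * y $ i)"
    by (rule sum.swap)
  also have "\<dots> = (\<Sum>i\<in>UNIV. (\<Sum>j\<in>UNIV. v $ j) * y $ i)"
    by (simp only: sum_shift_coords flip: sum_distrib_right)
  finally show ?thesis
    by (simp add: sum_distrib_left)
qed

lemma has_integral_cube_drain_shift_coords:
  fixes v :: "real^'n::{finite,wellorder,ab_group_add}"
  assumes "((\<lambda>y. (v \<bullet> y) powr (-1/2)) has_integral I) (cbox 0 1)"
  shows "((\<lambda>y. ((\<chi> i. v $ (i + k)) \<bullet> y) powr (-1/2)) has_integral I) (cbox 0 1)"
proof -
  have "(\<lambda>i. i - k) permutes UNIV"
    by (rule bij_imp_permutes) (auto intro!: bij_betwI[where g="\<lambda>i. i + k"])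
  from has_integral_unit_cube_permute_coords[OF this _ assms]
  show ?thesis
    by (simp add: inner_shift_coords)
qed

lemma cube_drain_integral_ge_mean:
  fixes v :: "real^'n::{finite,wellorder,ab_group_add}"
  assumes nonneg: "\<And>i. 0 \<le> v $ i" and pos: "0 < (\<Sum>i\<in>UNIV. v $ i)"
    and int: "(\<lambda>y. (v \<bullet> y) powr (-1/2)) integrable_on cbox 0 1"
    and J: "((\<lambda>y::real^'n::_. (\<Sum>i\<in>UNIV. y $ i) powr (-1/2)) has_integral J) (cbox 0 1)"
  shows "((\<Sum>i\<in>UNIV. v $ i) / CARD('n)) powr (-1/2) * J \<le> cube_drain_integral v"
proof -
  define s n F where "s = (\<Sum>i\<in>UNIV. v $ i)" and "n = real CARD('n)" and "F = cube_drain_integral v"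
  let ?t = "\<lambda>k y. (\<chi> i. v $ (i + k)) \<bullet> y"
  have n: "0 < n"
    by (simp add: n_def)
  have F: "((\<lambda>y. (v \<bullet> y) powr (-1/2)) has_integral F) (cbox 0 1)"
    unfolding F_def cube_drain_integral_def using int by (rule integrable_integral)
  have "((\<lambda>y. \<Sum>k\<in>UNIV. ?t k y powr (-1/2)) has_integral (\<Sum>k\<in>(UNIV :: 'n::_ set). F)) (cbox 0 1)"
    by (rule has_integral_sum) (simp, rule has_integral_cube_drain_shift_coords[OF F])
  then have sum_shifts: "((\<lambda>y. \<Sum>k\<in>UNIV. ?t k y powr (-1/2)) has_integral n * F) (box 0 1)"
    by (simp add: n_def has_integral_open_interval)
  have mean: "((\<lambda>y::real^'n::_. n * ((s / n) powr (-1/2) * (\<Sum>i\<in>UNIV. y $ i) powr (-1/2))) has_integral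
      n * ((s / n) powr (-1/2) * J)) (box 0 1)"
    using J by (intro has_integral_mult_right) (simp add: has_integral_open_interval)
  have pointwise: "n * ((s / n) powr (-1/2) * (\<Sum>i\<in>UNIV. y $ i) powr (-1/2))
      \<le> (\<Sum>k\<in>UNIV. ?t k y powr (-1/2))" if "y \<in> box 0 1" for y
  proof -
    have y: "\<And>i. 0 < y $ i"
      using that by (simp add: mem_box_cart)
    have "0 < ?t k y" for k
      using nonneg y pos
      by (intro inner_pos_if_coords_pos) (simp_all add: add.commute[of _ k] sum_shift_coords)
    then have "n * ((\<Sum>k\<in>UNIV. ?t k y) / n) powr (-1/2) \<le> (\<Sum>k\<in>UNIV. ?t k y powr (-1/2))"
      using powr_neg_half_mean_le[of UNIV "\<lambda>k. ?t k y"] by (simp add: n_def)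
    moreover have "((\<Sum>k\<in>UNIV. ?t k y) / n) powr (-1/2)
        = (s / n) powr (-1/2) * (\<Sum>i\<in>UNIV. y $ i) powr (-1/2)"
      using pos n y by (simp add: sum_inner_shift_coords s_def powr_mult less_imp_le sum_nonneg
          flip: times_divide_eq_left)
    ultimately show ?thesis
      by simp
  qed
  have "n * ((s / n) powr (-1/2) * J) \<le> n * F"
    using has_integral_le[OF mean sum_shifts pointwise] .
  then show ?thesis
    using n by (simp add: s_def F_def n_def)
qed

lemma sum_pos_if_nonneg_unit:
  fixes v :: "real^'n"
  assumes nonneg: "\<And>i. 0 \<le> v $ i" and unit: "norm v = 1"
  shows "0 < (\<Sum>i\<in>UNIV. v $ i)"
proof (rule ccontr)
  assume "\<not> 0 < (\<Sum>i\<in>UNIV. v $ i)"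
  then have "v = 0"
    using nonneg sum_nonneg_eq_0_iff[of UNIV "\<lambda>i. v $ i"]
    by (simp add: vec_eq_iff leD order.antisym sum_nonneg)
  then show False
    using unit by simp
qed

lemma cube_drain_integral_unit_ge:
  fixes v :: "real^'n::{finite,wellorder,ab_group_add}"
  assumes nonneg: "\<And>i. 0 \<le> v $ i" and unit: "norm v = 1"
    and int: "(\<lambda>y. (v \<bullet> y) powr (-1/2)) integrable_on cbox 0 1"
    and J: "((\<lambda>y::real^'n::_. (\<Sum>i\<in>UNIV. y $ i) powr (-1/2)) has_integral J) (cbox 0 1)"
  shows "CARD('n) powr (1/4) * J \<le> cube_drain_integral v"
proof -
  define s n where "s = (\<Sum>i\<in>UNIV. v $ i)" and "n = real CARD('n)"
  have n: "0 < n"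
    by (simp add: n_def)
  have "s = v \<bullet> 1"
    by (simp add: s_def inner_vec_def)
  also have "\<dots> \<le> norm v * norm (1 :: real^'n::_)"
    by (rule norm_cauchy_schwarz)
  also have "\<dots> = sqrt n"
    using unit by (simp add: norm_eq_sqrt_inner[of "1 :: real^'n::_"] inner_vec_def n_def)
  finally have "s / n \<le> sqrt n / n"
    using n by (simp add: divide_right_mono)
  also have "\<dots> = 1 / sqrt n"
    using n by (simp add: field_simps)
  also have "\<dots> = n powr (-1/2)"
    using n powr_neg_half[of n] by simp
  finally have s_le: "s / n \<le> n powr (-1/2)" .
  have s_pos: "0 < s"
    unfolding s_def using nonneg unit by (rule sum_pos_if_nonneg_unit)
  have "n powr (1/4) = (n powr (-1/2)) powr (-1/2)"
    by (simp add: powr_powr)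
  also have "\<dots> \<le> (s / n) powr (-1/2)"
    using s_pos n s_le by (intro powr_mono2') simp_all
  finally have "n powr (1/4) * J \<le> (s / n) powr (-1/2) * J"
    using J by (intro mult_right_mono has_integral_nonneg[OF J]) simp_all
  also have "\<dots> \<le> cube_drain_integral v"
    using cube_drain_integral_ge_mean[OF nonneg _ int J] s_pos by (simp add: s_def n_def)
  finally show ?thesis
    by (simp add: n_def)
qed

lemma cube_drain_integral_diagonal:
  assumes J: "((\<lambda>y::real^'n. (\<Sum>i\<in>UNIV. y $ i) powr (-1/2)) has_integral J) (cbox 0 1)"
  shows "cube_drain_integral (\<chi> i::'n. 1 / sqrt CARD('n)) = CARD('n) powr (1/4) * J"
proof -
  define n where "n = real CARD('n)"
  have "n powr (-1/2) = 1 / sqrt n"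
    by (rule powr_neg_half) (simp add: n_def)
  then have diag: "(\<chi> i::'n. 1 / sqrt n) \<bullet> y = n powr (-1/2) * (\<Sum>i\<in>UNIV. y $ i)" for y
    by (simp add: inner_vec_def sum_distrib_left)
  have "((\<chi> i::'n. 1 / sqrt n) \<bullet> y) powr (-1/2) = n powr (1/4) * (\<Sum>i\<in>UNIV. y $ i) powr (-1/2)"
    if "y \<in> cbox 0 1" for y
    using that by (simp add: diag powr_mult powr_powr mem_box_cart sum_nonneg)
  then have "((\<lambda>y. ((\<chi> i::'n. 1 / sqrt n) \<bullet> y) powr (-1/2)) has_integral n powr (1/4) * J) (cbox 0 1)"
    using has_integral_mult_right[OF J] by (simp cong: has_integral_cong)
  then show ?thesis
    by (simp add: cube_drain_integral_def integral_unique n_def)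
qed

section \<open>Iterated integrals over the unit cube in three dimensions\<close>

definition vec3 :: "real \<times> real \<times> real \<Rightarrow> real^3" where
  "vec3 p = vector [fst p, fst (snd p), snd (snd p)]"

lemma vec3_nth [simp]: "vec3 p $ 1 = fst p" "vec3 p $ 2 = fst (snd p)" "vec3 p $ 3 = snd (snd p)"
  by (simp_all add: vec3_def)

lemma vec3_measurable [measurable]: "vec3 \<in> borel_measurable borel"
proof (rule borel_measurable_continuous_onI)
  have vec3_lambda: "vec3 = (\<lambda>p. \<chi> i. if i = 1 then fst p else if i = 2 then fst (snd p) else snd (snd p))"
    by (simp add: fun_eq_iff vec_eq_iff forall_3)
  show "continuous_on UNIV vec3"
    unfolding vec3_lambda
  proof (intro continuous_on_vec_lambda)
    show "continuous_on UNIV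
        (\<lambda>p::real \<times> real \<times> real. if i = 1 then fst p else if i = 2 then fst (snd p) else snd (snd p))"
      for i :: 3
      by (cases "i = 1"; cases "i = 2") (auto intro!: continuous_intros)
  qed
qed

lemma prod_Basis_vec3:
  "(\<Prod>b\<in>(Basis :: (real^3) set). f b) = f (axis 1 1) * f (axis 2 1) * f (axis 3 1)"
proof -
  have Basis3: "(Basis :: (real^3) set) = {axis 1 1, axis 2 1, axis 3 1}"
    by (auto simp: Basis_vec_def UNIV_3)
  show ?thesis
    unfolding Basis3 by (simp add: axis_eq_axis mult.assoc)
qed

lemma distr_lborel_vec3: "distr lborel borel vec3 = (lborel :: (real^3) measure)"
proof (rule lborel_eqI[symmetric])
  fix l u :: "real^3"
  assume lu: "\<And>b. b \<in> Basis \<Longrightarrow> l \<bullet> b \<le> u \<bullet> b"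
  have le: "l $ i \<le> u $ i" for i
    using lu[of "axis i 1"] by (auto simp: Basis_vec_def cart_eq_inner_axis)
  let ?I = "\<lambda>i. {l $ i<..<u $ i}"
  have pre: "vec3 -` box l u = ?I 1 \<times> (?I 2 \<times> ?I 3)"
    by (auto simp: box_def Basis_vec_def cart_eq_inner_axis[symmetric] forall_3)
  have "emeasure (distr lborel borel vec3) (box l u)
      = emeasure (lborel :: (real \<times> real \<times> real) measure) (vec3 -` box l u)"
    by (simp add: emeasure_distr)
  also have "\<dots> = emeasure (lborel \<Otimes>\<^sub>M lborel) (?I 1 \<times> (?I 2 \<times> ?I 3))"
    unfolding pre lborel_prod ..
  also have "\<dots> = emeasure lborel (?I 1) * emeasure lborel (?I 2 \<times> ?I 3)"
    by (rule lborel.emeasure_pair_measure_Times) (auto intro!: borel_open open_Times)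
  also have "emeasure lborel (?I 2 \<times> ?I 3) = emeasure (lborel \<Otimes>\<^sub>M lborel) (?I 2 \<times> ?I 3)"
    unfolding lborel_prod ..
  also have "\<dots> = emeasure lborel (?I 2) * emeasure lborel (?I 3)"
    by (rule lborel.emeasure_pair_measure_Times) auto
  also have "emeasure lborel (?I 1) * (emeasure lborel (?I 2) * emeasure lborel (?I 3))
      = ennreal (\<Prod>b\<in>Basis. (u - l) \<bullet> b)"
    using le by (simp add: ennreal_mult' mult.assoc prod_Basis_vec3 cart_eq_inner_axis[symmetric])
  finally show "emeasure (distr lborel borel vec3) (box l u) = ennreal (\<Prod>b\<in>Basis. (u - l) \<bullet> b)" .
qed simp

lemma nn_integral_lborel_vec3:
  fixes g :: "real^3 \<Rightarrow> ennreal"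
  assumes [measurable]: "g \<in> borel_measurable borel"
  shows "(\<integral>\<^sup>+x. g x \<partial>lborel) = (\<integral>\<^sup>+a. \<integral>\<^sup>+b. \<integral>\<^sup>+c. g (vec3 (a, b, c)) \<partial>lborel \<partial>lborel \<partial>lborel)"
proof -
  have "(\<integral>\<^sup>+x. g x \<partial>lborel) = (\<integral>\<^sup>+x. g x \<partial>(distr lborel borel vec3))"
    by (simp add: distr_lborel_vec3)
  also have "\<dots> = (\<integral>\<^sup>+p. g (vec3 p) \<partial>lborel)"
    by (rule nn_integral_distr) auto
  also have "\<dots> = (\<integral>\<^sup>+p. g (vec3 p) \<partial>(lborel \<Otimes>\<^sub>M lborel))"
    by (simp add: lborel_prod)
  also have "\<dots> = (\<integral>\<^sup>+a. \<integral>\<^sup>+q. g (vec3 (a, q)) \<partial>lborel \<partial>lborel)"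
    by (rule lborel.nn_integral_fst[symmetric]) (simp add: lborel_prod)
  also have "\<dots> = (\<integral>\<^sup>+a. \<integral>\<^sup>+q. g (vec3 (a, q)) \<partial>(lborel \<Otimes>\<^sub>M lborel) \<partial>lborel)"
    by (simp add: lborel_prod)
  also have "\<dots> = (\<integral>\<^sup>+a. \<integral>\<^sup>+b. \<integral>\<^sup>+c. g (vec3 (a, b, c)) \<partial>lborel \<partial>lborel \<partial>lborel)"
    by (intro nn_integral_cong lborel.nn_integral_fst[symmetric]) (simp add: lborel_prod)
  finally show ?thesis .
qed

definition unit_cube_iterated_integral :: "(real \<Rightarrow> real \<Rightarrow> real \<Rightarrow> real) \<Rightarrow> ennreal" where
  "unit_cube_iterated_integral f = (\<integral>\<^sup>+a. \<integral>\<^sup>+b. \<integral>\<^sup>+c.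
     ennreal (f a b c * indicator {0<..<1} a * indicator {0<..<1} b * indicator {0<..<1} c)
     \<partial>lborel \<partial>lborel \<partial>lborel)"

lemma unit_cube_iterated_integral_eqI:
  assumes inner: "\<And>a b. a \<in> {0<..<1} \<Longrightarrow> b \<in> {0<..<1} \<Longrightarrow>
      (\<integral>\<^sup>+c. ennreal (f a b c * indicator {0<..<1} c) \<partial>lborel) = ennreal (g a b)"
    and middle: "\<And>a. a \<in> {0<..<1} \<Longrightarrow> (\<integral>\<^sup>+b. ennreal (g a b * indicator {0<..<1} b) \<partial>lborel) = ennreal (h a)"
    and outer: "(\<integral>\<^sup>+a. ennreal (h a * indicator {0<..<1} a) \<partial>lborel) = ennreal r"
  shows "unit_cube_iterated_integral f = ennreal r"
proof -
  have inner': "(\<integral>\<^sup>+c. ennreal (f a b c * indicator {0<..<1} a * indicator {0<..<1} b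
      * indicator {0<..<1} c) \<partial>lborel)
      = ennreal (g a b * indicator {0<..<1} a * indicator {0<..<1} b)" for a b
    using inner[of a b] by (cases "a \<in> {0<..<1} \<and> b \<in> {0<..<1}") (auto simp: indicator_def)
  have middle': "(\<integral>\<^sup>+b. ennreal (g a b * indicator {0<..<1} a * indicator {0<..<1} b) \<partial>lborel)
      = ennreal (h a * indicator {0<..<1} a)" for a
    using middle[of a] by (cases "a \<in> {0<..<1}") (auto simp: indicator_def)
  show ?thesis
    unfolding unit_cube_iterated_integral_def by (simp only: inner' middle' outer)
qed

lemma unit_cube_iterated_integral_mono:
  assumes "\<And>a b c. a \<in> {0<..<1} \<Longrightarrow> b \<in> {0<..<1} \<Longrightarrow> c \<in> {0<..<1} \<Longrightarrow> f a b c \<le> g a b c"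
  shows "unit_cube_iterated_integral f \<le> unit_cube_iterated_integral g"
  unfolding unit_cube_iterated_integral_def
  by (intro nn_integral_mono) (auto simp: indicator_def assms ennreal_leI)

lemma vector3_mem_box_01:
  "(vector [a, b, c] :: real^3) \<in> box 0 1 \<longleftrightarrow> a \<in> {0<..<1} \<and> b \<in> {0<..<1} \<and> c \<in> {0<..<1}"
  by (auto simp: mem_box_cart forall_3)

lemma has_integral_unit_cube_iterated:
  fixes f :: "real^3 \<Rightarrow> real"
  assumes [measurable]: "f \<in> borel_measurable borel" and nonneg: "\<And>x. 0 \<le> f x"
    and iterated: "unit_cube_iterated_integral (\<lambda>a b c. f (vector [a, b, c])) = ennreal r" and "0 \<le> r"
  shows "(f has_integral r) (cbox 0 1)"
proof -
  let ?g = "\<lambda>x. f x * indicator (box 0 1) x"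
  have "(\<integral>\<^sup>+x. ennreal (?g x) \<partial>lborel)
      = (\<integral>\<^sup>+a. \<integral>\<^sup>+b. \<integral>\<^sup>+c. ennreal (?g (vec3 (a, b, c))) \<partial>lborel \<partial>lborel \<partial>lborel)"
    by (rule nn_integral_lborel_vec3) measurable
  also have "\<dots> = unit_cube_iterated_integral (\<lambda>a b c. f (vector [a, b, c]))"
    unfolding unit_cube_iterated_integral_def
    by (intro nn_integral_cong) (auto simp: vec3_def indicator_def vector3_mem_box_01)
  finally have "(?g has_integral r) UNIV"
    using nonneg \<open>0 \<le> r\<close> iterated by (intro nn_integral_has_integral) auto
  moreover have "?g = (\<lambda>x. if x \<in> box 0 1 then f x else 0)"
    by (auto simp: indicator_def)
  ultimately have "(f has_integral r) (box 0 1)"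
    by (simp add: has_integral_restrict_UNIV)
  then show ?thesis
    by (rule has_integral_open_interval[THEN iffD1])
qed

lemma nn_integral_open_interval_FTC:
  fixes F f :: "real \<Rightarrow> real"
  assumes "a < b" and "continuous_on {a..b} F"
    and "\<And>x. x \<in> {a<..<b} \<Longrightarrow> (F has_real_derivative f x) (at x)"
    and nonneg: "\<And>x. x \<in> {a<..<b} \<Longrightarrow> 0 \<le> f x"
  shows "(\<integral>\<^sup>+x. ennreal (f x * indicator {a<..<b} x) \<partial>lborel) = ennreal (F b - F a)"
    and "0 \<le> F b - F a"
proof -
  have "(f has_integral (F b - F a)) {a..b}"
    using assms by (intro fundamental_theorem_of_calculus_interior)
      (auto simp: has_real_derivative_iff_has_vector_derivative[symmetric])
  then have I: "(f has_integral (F b - F a)) {a<..<b}"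
    using has_integral_open_interval[of f _ a b] by simp
  then have "(\<integral>\<^sup>+x. ennreal (f x) * indicator {a<..<b} x \<partial>lborel) = ennreal (F b - F a)"
    using nonneg by (intro nn_integral_has_integral_lebesgue')
  moreover have "ennreal (f x * indicator {a<..<b} x) = ennreal (f x) * indicator {a<..<b} x" for x
    by (simp add: indicator_def)
  ultimately show "(\<integral>\<^sup>+x. ennreal (f x * indicator {a<..<b} x) \<partial>lborel) = ennreal (F b - F a)"
    by simp
  show "0 \<le> F b - F a"
    using I nonneg by (rule has_integral_nonneg)
qed

lemma DERIV_sqrt_shift:
  "0 < p + x \<Longrightarrow> ((\<lambda>x. sqrt (p + x)) has_real_derivative 1 / (2 * sqrt (p + x))) (at x)"
  by (auto intro!: derivative_eq_intros simp: field_simps)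

lemma DERIV_shift_mult_sqrt:
  "0 < p + x \<Longrightarrow> ((\<lambda>x. (p + x) * sqrt (p + x)) has_real_derivative 3 / 2 * sqrt (p + x)) (at x)"
  by (auto intro!: derivative_eq_intros simp: field_simps)

lemma DERIV_shift_square_mult_sqrt:
  "0 < p + x \<Longrightarrow>
    ((\<lambda>x. (p + x)\<^sup>2 * sqrt (p + x)) has_real_derivative 5 / 2 * ((p + x) * sqrt (p + x))) (at x)"
  by (auto intro!: derivative_eq_intros simp: field_simps power2_eq_square)

lemma nn_integral_inv_sqrt_shift:
  assumes "0 \<le> p" and "0 \<le> C"
  shows "(\<integral>\<^sup>+c. ennreal (C * (p + c) powr (-1/2) * indicator {0<..<1} c) \<partial>lborel)
    = ennreal (2 * C * (sqrt (p + 1) - sqrt p))"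
proof -
  let ?F = "\<lambda>c. 2 * C * sqrt (p + c)"
  have "(?F has_real_derivative C * (p + x) powr (-1/2)) (at x)"
    if "x \<in> {0<..<1}" for x
  proof -
    have "0 < p + x"
      using that assms by simp
    then show ?thesis
      using DERIV_cmult[OF DERIV_sqrt_shift, of p x "2 * C"] powr_neg_half[of "p + x"] by simp
  qed
  then have "(\<integral>\<^sup>+c. ennreal (C * (p + c) powr (-1/2) * indicator {0<..<1} c) \<partial>lborel)
      = ennreal (?F 1 - ?F 0)"
    using assms by (intro nn_integral_open_interval_FTC(1)) (auto intro!: continuous_intros)
  then show ?thesis
    by (simp add: algebra_simps)
qed

lemma nn_integral_sqrt_shift_diff:
  assumes "0 < a"
  shows "(\<integral>\<^sup>+b. ennreal ((2 * sqrt (a + b + 1) - 2 * sqrt (a + b)) * indicator {0<..<1} b) \<partial>lborel)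
       = ennreal (4/3 * ((2 + a) * sqrt (2 + a) - 2 * ((1 + a) * sqrt (1 + a)) + a * sqrt a))"
    and "0 \<le> 4/3 * ((2 + a) * sqrt (2 + a) - 2 * ((1 + a) * sqrt (1 + a)) + a * sqrt a)"
proof -
  let ?F = "\<lambda>b. 4/3 * (((a + 1) + b) * sqrt ((a + 1) + b) - (a + b) * sqrt (a + b))"
  have eq: "?F 1 - ?F 0 = 4/3 * ((2 + a) * sqrt (2 + a) - 2 * ((1 + a) * sqrt (1 + a)) + a * sqrt a)"
    by (simp add: algebra_simps)
  have cont: "continuous_on {0..1} ?F"
    by (intro continuous_intros)
  have der: "(?F has_real_derivative (2 * sqrt (a + b + 1) - 2 * sqrt (a + b))) (at b)"
    if "b \<in> {0<..<1}" for b
  proof -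
    have "0 < (a + 1) + b" "0 < a + b"
      using that assms by auto
    then have "(?F has_real_derivative 4/3 * (3/2 * sqrt ((a + 1) + b) - 3/2 * sqrt (a + b))) (at b)"
      by (intro DERIV_cmult DERIV_diff DERIV_shift_mult_sqrt)
    then show ?thesis
      by (simp add: algebra_simps)
  qed
  have nonneg: "0 \<le> 2 * sqrt (a + b + 1) - 2 * sqrt (a + b)" if "b \<in> {0<..<1}" for b
    using that assms by auto
  show "(\<integral>\<^sup>+b. ennreal ((2 * sqrt (a + b + 1) - 2 * sqrt (a + b)) * indicator {0<..<1} b) \<partial>lborel)
       = ennreal (4/3 * ((2 + a) * sqrt (2 + a) - 2 * ((1 + a) * sqrt (1 + a)) + a * sqrt a))"
    using nn_integral_open_interval_FTC(1)[of 0 1 ?F, OF _ cont der nonneg] unfolding eq by simp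
  show "0 \<le> 4/3 * ((2 + a) * sqrt (2 + a) - 2 * ((1 + a) * sqrt (1 + a)) + a * sqrt a)"
    using nn_integral_open_interval_FTC(2)[of 0 1 ?F, OF _ cont der nonneg] unfolding eq by simp
qed

lemma nn_integral_three_halves_diff:
  shows "(\<integral>\<^sup>+a. ennreal (4/3 * ((2 + a) * sqrt (2 + a) - 2 * ((1 + a) * sqrt (1 + a)) + a * sqrt a)
      * indicator {0<..<1} a) \<partial>lborel) = ennreal (8/5 * (1 + 3 * sqrt 3 - 4 * sqrt 2))"
    and "0 \<le> 8/5 * (1 + 3 * sqrt 3 - 4 * sqrt 2)"
proof -
  let ?F = "\<lambda>a. 8/15 * ((2 + a)\<^sup>2 * sqrt (2 + a) - 2 * ((1 + a)\<^sup>2 * sqrt (1 + a))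
    + (0 + a)\<^sup>2 * sqrt (0 + a))"
  have "sqrt 9 = 3" "sqrt 4 = 2"
    by (simp_all add: real_sqrt_eq_iff)
  then have eq: "?F 1 - ?F 0 = 8/5 * (1 + 3 * sqrt 3 - 4 * sqrt 2)"
    by (simp add: algebra_simps power2_eq_square)
  have cont: "continuous_on {0..1} ?F"
    by (intro continuous_intros)
  have der: "(?F has_real_derivative
      4/3 * ((2 + a) * sqrt (2 + a) - 2 * ((1 + a) * sqrt (1 + a)) + a * sqrt a)) (at a)"
    if "a \<in> {0<..<1}" for a
  proof -
    have "0 < 2 + a" "0 < 1 + a" "0 < 0 + a"
      using that by auto
    then have "(?F has_real_derivative 8/15 * (5/2 * ((2 + a) * sqrt (2 + a))
        - 2 * (5/2 * ((1 + a) * sqrt (1 + a))) + 5/2 * ((0 + a) * sqrt (0 + a)))) (at a)"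
      by (intro DERIV_cmult DERIV_diff DERIV_add DERIV_shift_square_mult_sqrt)
    then show ?thesis
      by (simp add: algebra_simps)
  qed
  have nonneg: "0 \<le> 4/3 * ((2 + a) * sqrt (2 + a) - 2 * ((1 + a) * sqrt (1 + a)) + a * sqrt a)"
    if "a \<in> {0<..<1}" for a
    using nn_integral_sqrt_shift_diff(2)[of a] that by simp
  show "(\<integral>\<^sup>+a. ennreal (4/3 * ((2 + a) * sqrt (2 + a) - 2 * ((1 + a) * sqrt (1 + a)) + a * sqrt a)
      * indicator {0<..<1} a) \<partial>lborel) = ennreal (8/5 * (1 + 3 * sqrt 3 - 4 * sqrt 2))"
    using nn_integral_open_interval_FTC(1)[of 0 1 ?F, OF _ cont der nonneg] unfolding eq by simp
  show "0 \<le> 8/5 * (1 + 3 * sqrt 3 - 4 * sqrt 2)"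
    using nn_integral_open_interval_FTC(2)[of 0 1 ?F, OF _ cont der nonneg] unfolding eq by simp
qed

lemma has_integral_inv_sqrt_coord_sum3:
  "((\<lambda>y::real^3. (\<Sum>i\<in>UNIV. y $ i) powr (-1/2)) has_integral 8/5 * (1 + 3 * sqrt 3 - 4 * sqrt 2)) (cbox 0 1)"
proof (rule has_integral_unit_cube_iterated)
  show "unit_cube_iterated_integral (\<lambda>a b c. (\<Sum>i\<in>UNIV. (vector [a, b, c] :: real^3) $ i) powr (-1/2))
      = ennreal (8/5 * (1 + 3 * sqrt 3 - 4 * sqrt 2))"
  proof (rule unit_cube_iterated_integral_eqI)
    fix a b :: real assume "a \<in> {0<..<1}" "b \<in> {0<..<1}"
    then show "(\<integral>\<^sup>+c. ennreal ((\<Sum>i\<in>UNIV. (vector [a, b, c] :: real^3) $ i) powr (-1/2)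
        * indicator {0<..<1} c) \<partial>lborel)
        = ennreal (2 * sqrt (a + b + 1) - 2 * sqrt (a + b))"
      using nn_integral_inv_sqrt_shift[of "a + b" 1] by (simp add: sum_3 algebra_simps)
  next
    fix a :: real assume "a \<in> {0<..<1}"
    then show "(\<integral>\<^sup>+b. ennreal ((2 * sqrt (a + b + 1) - 2 * sqrt (a + b)) * indicator {0<..<1} b) \<partial>lborel)
        = ennreal (4/3 * ((2 + a) * sqrt (2 + a) - 2 * ((1 + a) * sqrt (1 + a)) + a * sqrt a))"
      by (simp add: nn_integral_sqrt_shift_diff(1))
  qed (rule nn_integral_three_halves_diff(1))
qed (use nn_integral_three_halves_diff(2) in auto)

lemma integrable_inv_sqrt_inner3:
  fixes v :: "real^3"
  assumes nonneg: "\<And>i. 0 \<le> v $ i" and pos: "0 < (\<Sum>i\<in>UNIV. v $ i)"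
  shows "(\<lambda>y. (v \<bullet> y) powr (-1/2)) integrable_on cbox 0 1"
proof -
  define M where "M = (\<Sum>i\<in>UNIV. v $ i) powr (-1/2)"
  have "0 \<le> M"
    by (simp add: M_def)
  let ?f = "\<lambda>a b c. (v \<bullet> (vector [a, b, c] :: real^3)) powr (-1/2)"
  let ?g = "\<lambda>a b c. M * a powr (-1/2) * b powr (-1/2) * c powr (-1/2)"
  text \<open>On the open unit cube \<open>a b c \<le> min a b c\<close>, so \<open>v \<bullet> y \<ge> (\<Sum>i. v $ i) a b c\<close>
    and the integrand is dominated by a product of one-dimensional integrable functions.\<close>
  have "?f a b c \<le> ?g a b c" if "a \<in> {0<..<1}" "b \<in> {0<..<1}" "c \<in> {0<..<1}" for a b c
  proof -
    have abc: "0 < a * b * c"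
      using that by auto
    have "a * b * c \<le> a" "a * b * c \<le> b" "a * b * c \<le> c"
      using that by (auto simp: mult_le_cancel_left1 mult_le_cancel_right1 mult.assoc intro: mult_le_one)
    then have "(\<Sum>i\<in>UNIV. v $ i) * (a * b * c) \<le> v \<bullet> (vector [a, b, c] :: real^3)"
      using nonneg[of 1] nonneg[of 2] nonneg[of 3]
      by (simp add: sum_3 inner_vec_def distrib_right mult_left_mono add_mono)
    then have "?f a b c \<le> ((\<Sum>i\<in>UNIV. v $ i) * (a * b * c)) powr (-1/2)"
      using abc pos by (intro powr_mono2') auto
    also have "\<dots> = ?g a b c"
      using abc pos that by (simp add: M_def powr_mult)
    finally show ?thesis .
  qed
  then have "unit_cube_iterated_integral ?f \<le> unit_cube_iterated_integral ?g"
    by (rule unit_cube_iterated_integral_mono)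
  also have "unit_cube_iterated_integral ?g = ennreal (8 * M)"
  proof (rule unit_cube_iterated_integral_eqI)
    show "(\<integral>\<^sup>+c. ennreal (?g a b c * indicator {0<..<1} c) \<partial>lborel)
        = ennreal (2 * M * a powr (-1/2) * b powr (-1/2))" for a b
      using nn_integral_inv_sqrt_shift[of 0 "M * a powr (-1/2) * b powr (-1/2)"] \<open>0 \<le> M\<close> by (simp add: mult_ac)
    show "(\<integral>\<^sup>+b. ennreal (2 * M * a powr (-1/2) * b powr (-1/2) * indicator {0<..<1} b) \<partial>lborel)
        = ennreal (4 * M * a powr (-1/2))" for a
      using nn_integral_inv_sqrt_shift[of 0 "2 * M * a powr (-1/2)"] \<open>0 \<le> M\<close> by (simp add: mult_ac)
    show "(\<integral>\<^sup>+a. ennreal (4 * M * a powr (-1/2) * indicator {0<..<1} a) \<partial>lborel)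
        = ennreal (8 * M)"
      using nn_integral_inv_sqrt_shift[of 0 "4 * M"] \<open>0 \<le> M\<close> by (simp add: mult_ac)
  qed
  finally have "unit_cube_iterated_integral ?f \<noteq> \<infinity>"
    by (auto simp: top_unique)
  then have "unit_cube_iterated_integral ?f = ennreal (enn2real (unit_cube_iterated_integral ?f))"
    by (simp add: less_top[symmetric])
  then have "((\<lambda>y. (v \<bullet> y) powr (-1/2)) has_integral enn2real (unit_cube_iterated_integral ?f))
      (cbox 0 1)"
    by (intro has_integral_unit_cube_iterated) auto
  then show ?thesis
    by blast
qed

section \<open>The drainage time of the placed cube\<close>

lemma zc_matrix_vector_mult: "zc (Q *v x) = Q $ 3 \<bullet> x"
  by (simp add: zc_def matrix_vector_mult_def inner_vec_def)

lemma low_eq_sum_min: "low Q = (\<Sum>i\<in>UNIV. min (Q $ 3 $ i) 0)"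
  unfolding low_def unit_cube_def zc_matrix_vector_mult by (rule Inf_inner_unit_cube)

lemma placed_eq_affine_image:
  "placed Q = (\<lambda>y. (Q ** cube_reflection (Q $ 3)) *v y
     + (Q *v negative_coords (Q $ 3) - low Q *\<^sub>R axis 3 1)) ` cbox 0 1"
proof -
  have "placed Q = (\<lambda>x. Q *v x - low Q *\<^sub>R axis 3 1)
      ` (\<lambda>y. cube_reflection (Q $ 3) *v y + negative_coords (Q $ 3)) ` cbox 0 1"
    by (simp only: placed_def unit_cube_def cube_reflection_image)
  then show ?thesis
    by (simp add: image_comp o_def matrix_vector_mul_assoc matrix_vector_right_distrib algebra_simps)
qed

lemma zc_placed_eq_inner_abs:
  "zc ((Q ** cube_reflection (Q $ 3)) *v y + (Q *v negative_coords (Q $ 3) - low Q *\<^sub>R axis 3 1))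
     = (\<chi> i. \<bar>Q $ 3 $ i\<bar>) \<bullet> y"
proof -
  have "zc ((Q ** cube_reflection (Q $ 3)) *v y + (Q *v negative_coords (Q $ 3) - low Q *\<^sub>R axis 3 1))
      = zc (Q *v (cube_reflection (Q $ 3) *v y + negative_coords (Q $ 3))) - low Q"
    by (simp add: zc_def matrix_vector_mul_assoc[symmetric] matrix_vector_right_distrib axis_def)
  then show ?thesis
    by (simp add: zc_matrix_vector_mult inner_cube_reflection low_eq_sum_min)
qed

lemma norm_row_orthogonal_matrix:
  fixes Q :: "real^'n^'n"
  assumes "orthogonal_matrix Q"
  shows "norm (Q $ i) = 1"
  using assms by (simp add: orthogonal_matrix_orthonormal_rows row_def)

lemma norm_abs_bottom_row:
  fixes Q :: "real^3^3"
  assumes "rotation_matrix Q"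
  shows "norm (\<chi> i. \<bar>Q $ 3 $ i\<bar>) = 1"
proof -
  have "norm (\<chi> i. \<bar>Q $ 3 $ i\<bar>) = norm (Q $ 3)"
    by (simp add: norm_vec_def)
  also have "\<dots> = 1"
    using assms by (simp add: rotation_matrix_def norm_row_orthogonal_matrix)
  finally show ?thesis .
qed

lemma integrable_inv_sqrt_abs_bottom_row:
  fixes Q :: "real^3^3"
  assumes "rotation_matrix Q"
  shows "(\<lambda>y. ((\<chi> i. \<bar>Q $ 3 $ i\<bar>) \<bullet> y) powr (-1/2)) integrable_on cbox 0 1"
  using norm_abs_bottom_row[OF assms]
  by (intro integrable_inv_sqrt_inner3 sum_pos_if_nonneg_unit) simp_all

lemma drain_time_eq_cube_drain_integral:
  assumes "rotation_matrix Q"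
  shows "drain_time K Q = cube_drain_integral (\<chi> i. \<bar>Q $ 3 $ i\<bar>) / K"
proof -
  let ?u = "\<chi> i. \<bar>Q $ 3 $ i\<bar>"
  have "((\<lambda>y. (?u \<bullet> y) powr (-1/2)) has_integral cube_drain_integral ?u) (cbox 0 1)"
    unfolding cube_drain_integral_def
    using integrable_inv_sqrt_abs_bottom_row[OF assms] by (rule integrable_integral)
  moreover have "\<bar>det (Q ** cube_reflection (Q $ 3))\<bar> = 1"
    using assms by (simp add: det_mul abs_mult abs_det_cube_reflection rotation_matrix_def)
  ultimately have "((\<lambda>p. zc p powr (-1/2)) has_integral cube_drain_integral ?u) (placed Q)"
    unfolding placed_eq_affine_image
    by (intro has_integral_unimodular_affine_image) (simp_all add: zc_placed_eq_inner_abs)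
  then show ?thesis
    by (simp add: drain_time_def integral_unique)
qed

lemma diagonal_vertical_abs_row:
  assumes rot: "rotation_matrix Q" and "diagonal_vertical Q"
  shows "(\<chi> i. \<bar>Q $ 3 $ i\<bar>) = (\<chi> i. 1 / sqrt 3)"
proof -
  have orth: "orthogonal_matrix Q"
    using rot by (simp add: rotation_matrix_def)
  obtain d :: "real^3" and c where d: "\<forall>i. d $ i = 1 \<or> d $ i = -1" and Qd: "Q *v d = c *\<^sub>R axis 3 1"
    using assms(2) unfolding diagonal_vertical_def by blast
  have "d = transpose Q *v (Q *v d)"
    using orth by (simp add: matrix_vector_mul_assoc orthogonal_matrix_def)
  then have "d = transpose Q *v (c *\<^sub>R axis 3 1)"
    by (simp add: Qd)
  then have dc: "d $ j = c * Q $ 3 $ j" for j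
    by (simp add: matrix_vector_mult_def transpose_def axis_def sum_3)
  have d_sq: "(d $ j)\<^sup>2 = 1" for j
    using d by (metis power2_minus power_one)
  have "3 = (\<Sum>j\<in>UNIV. (d $ j)\<^sup>2)"
    by (simp add: d_sq)
  also have "\<dots> = c\<^sup>2 * (Q $ 3 \<bullet> Q $ 3)"
    by (simp add: dc inner_vec_def sum_distrib_left power2_eq_square mult_ac)
  also have "Q $ 3 \<bullet> Q $ 3 = 1"
    using norm_row_orthogonal_matrix[OF orth] by (simp add: norm_eq_1[symmetric])
  finally have "c\<^sup>2 = 3"
    by simp
  then have "(Q $ 3 $ i)\<^sup>2 = 1 / 3" for i
    using d_sq[of i] dc[of i] by (simp add: power_mult_distrib field_simps)
  then have "\<bar>Q $ 3 $ i\<bar> = sqrt (1 / 3)" for i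
    by (metis real_sqrt_abs)
  then show ?thesis
    by (simp add: vec_eq_iff real_sqrt_divide)
qed

lemma exists_rotation_diagonal_vertical: "\<exists>Q. rotation_matrix Q \<and> diagonal_vertical Q"
proof -
  let ?a = "\<chi> i::3. 1 / sqrt 3"
  have "norm ?a = 1"
    by (simp add: norm_vec_def L2_set_def power_divide)
  then obtain A where A: "rotation_matrix A" and Ae: "A *v axis 3 1 = ?a"
    using rotation_matrix_exists_basis[of ?a] by auto
  have "transpose A *v 1 = sqrt 3 *\<^sub>R (transpose A *v ?a)"
    by (simp add: vec_eq_iff matrix_vector_mult_def sum_distrib_left)
  also have "transpose A *v ?a = axis 3 1"
    using A by (simp add: Ae[symmetric] matrix_vector_mul_assoc rotation_matrix_def orthogonal_matrix_def)
  finally have "transpose A *v 1 = sqrt 3 *\<^sub>R axis 3 1" .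
  moreover have "rotation_matrix (transpose A)"
    using A by (simp add: rotation_matrix_def)
  ultimately show ?thesis
    unfolding diagonal_vertical_def by (metis one_index)
qed

lemma drain_time_ge:
  assumes "0 < K" and "rotation_matrix Q"
  shows "3 powr (1/4) * (8/5 * (1 + 3 * sqrt 3 - 4 * sqrt 2)) / K \<le> drain_time K Q"
proof -
  have "3 powr (1/4) * (8/5 * (1 + 3 * sqrt 3 - 4 * sqrt 2)) \<le> cube_drain_integral (\<chi> i. \<bar>Q $ 3 $ i\<bar>)"
    using cube_drain_integral_unit_ge[OF _ norm_abs_bottom_row integrable_inv_sqrt_abs_bottom_row
        has_integral_inv_sqrt_coord_sum3] assms(2)
    by simp
  then have "3 powr (1/4) * (8/5 * (1 + 3 * sqrt 3 - 4 * sqrt 2)) / K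
      \<le> cube_drain_integral (\<chi> i. \<bar>Q $ 3 $ i\<bar>) / K"
    by (rule divide_right_mono) (use assms(1) in simp)
  then show ?thesis
    by (simp only: drain_time_eq_cube_drain_integral[OF assms(2)])
qed

lemma drain_time_diagonal_vertical:
  assumes "rotation_matrix Q" and "diagonal_vertical Q"
  shows "drain_time K Q = 3 powr (1/4) * (8/5 * (1 + 3 * sqrt 3 - 4 * sqrt 2)) / K"
proof -
  have "cube_drain_integral (\<chi> i::3. 1 / sqrt 3) = 3 powr (1/4) * (8/5 * (1 + 3 * sqrt 3 - 4 * sqrt 2))"
    using cube_drain_integral_diagonal[OF has_integral_inv_sqrt_coord_sum3] by simp
  then show ?thesis
    by (simp only: drain_time_eq_cube_drain_integral diagonal_vertical_abs_row assms)
qed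

theorem theorem2:
  fixes K :: real
  assumes "K > 0"
  shows "(\<forall>Q. rotation_matrix Q \<longrightarrow>
            8 * root 4 3 / (5 * K) * (1 + 3 * sqrt 3 - 4 * sqrt 2) \<le> drain_time K Q)
       \<and> (\<forall>Q. rotation_matrix Q \<and> diagonal_vertical Q \<longrightarrow>
            drain_time K Q = 8 * root 4 3 / (5 * K) * (1 + 3 * sqrt 3 - 4 * sqrt 2))
       \<and> T_min K = 8 * root 4 3 / (5 * K) * (1 + 3 * sqrt 3 - 4 * sqrt 2)"
proof -
  have closed_form: "8 * root 4 3 / (5 * K) * (1 + 3 * sqrt 3 - 4 * sqrt 2)
      = 3 powr (1/4) * (8/5 * (1 + 3 * sqrt 3 - 4 * sqrt 2)) / K"
    by (simp add: root_powr_inverse)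
  have T_min: "T_min K = 3 powr (1/4) * (8/5 * (1 + 3 * sqrt 3 - 4 * sqrt 2)) / K"
    unfolding T_min_def
  proof (rule cInf_eq_minimum)
    obtain Q where "rotation_matrix Q" "diagonal_vertical Q"
      using exists_rotation_diagonal_vertical by blast
    then show "3 powr (1/4) * (8/5 * (1 + 3 * sqrt 3 - 4 * sqrt 2)) / K
        \<in> drain_time K ` {Q. rotation_matrix Q}"
      by (metis (mono_tags) drain_time_diagonal_vertical image_eqI mem_Collect_eq)
  qed (use drain_time_ge assms in auto)
  show ?thesis
    unfolding closed_form T_min using drain_time_ge[OF assms] drain_time_diagonal_vertical by blast
qed

end
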